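(* Let $M=(V,E,F)$ be a simply connected discrete surface with dual $M^*=(V^*,E^*,F^* )$ and let $N:V\to\mathbb{S}^2$ be an admissible realization of $M$. (i) If $f:V^*\to\mathbb{R}^3$ is A-minimal with Gauss map $N$, then there is a C-minimal surface $\tilde f:V^*\to\mathbb{R}^3$ with Gauss map $N$ such that for every interior edge $\{ij\}$ $$d\tilde f(e^*_{ij}) = N_i\times df(e^*_{ij}) = N_j\times df(e^*_{ij}). \qquad ( * )$$ (ii) Conversely, if $\tilde f:V^*\to\mathbb{R}^3$ is C-minimal with Gauss map $N$, then there is an A-minimal surface $f:V^*\to\mathbb{R}^3$ with Gauss map $N$ such that $( * )$ holds for every interior edge $\{ij\}$.
   Context: A discrete surface is a cell decomposition $M=(V,E,F)$ of an oriented surface, with or without boundary; $V_{int}$ and $E_{int}$ denote the interior vertices and interior edges. $M^*=(V^*,E^*,F^* )$ is the dual cell decomposition: elements of $V^*$ correspond to faces of $M$, and each $i\in V$ corresponds to a dual face $i^*\in F^*$; $F^*_{int}$ denotes the dual faces of interior vertices. $e_{ij}$ is the oriented edge from $i$ to $j$; for an interior edge, $e_{ij}^*$ is the dual edge oriented from the right face $\phi_r$ of $e_{ij}$ to its left face $\phi_l$. For $N$ defined on $V$, $dN(e_{ij})=N_j-N_i$; for $f$ defined on $V^*$, $df(e^*_{ij})=f_{\phi_l}-f_{\phi_r}$. Sums $\sum_j$ run over the neighbors $j$ of $i$. A realization of $M$ is an assignment of positions to its vertices (similarly for $M^*$). A realization $N:V\to\mathbb{S}^2\subset\mathbb{R}^3$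 is admissible if $N_i\neq -N_j$ for every edge $\{ij\}$. A realization $f:V^*\to\mathbb{R}^3$ is A-minimal with Gauss map $N:V\to\mathbb{S}^2$ if $N$ is admissible and for every interior edge $\{ij\}$: $dN(e_{ij})\times df(e^*_{ij})=0$ and $\langle N_i+N_j, df(e^*_{ij})\rangle=0$. A realization $\tilde f:V^*\to\mathbb{R}^3$ is C-minimal with Gauss map $N:V\to\mathbb{S}^2$ if $N$ is admissible, $\tilde f$ has planar faces with face normal $N$ (i.e. $N_i$ and $N_j$ are both orthogonal to $d\tilde f(e^*_{ij})$ for every interior edge $\{ij\}$), and the scalar mean curvature $\tilde H_i:=\sum_j |d\tilde f(e^*_{ij})|\tan\frac{\alpha_{ij}}{2}$ vanishes for every $i\in V_{int}$. Here, if $d\tilde f(e^*_{ij})\ne0$, the dihedral angle $\alpha_{ij}\in(-\pi,\pi)$ is determined by $\sin\alpha_{ij}=\langle N_i\times N_j, d\tilde f(e^*_{ij})/|d\tilde f(e^*_{ij})|\rangle$ and $\cos\alpha_{ij}=\langle N_i,N_j\rangle$; if $d\tilde f(e^*_{ij})=0$ the term $|d\tilde f(e^*_{ij})|\tan\frac{\alpha_{ij}}{2}$ is $0$. *)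

theory Defs
  imports "HOL-Analysis.Analysis"
begin

section \<open>Cell decompositions of oriented surfaces\<close>

text \<open>
  A cell decomposition is encoded by its oriented edges (darts). Every unoriented edge, boundary
  edges included, is given by the two distinct darts \<open>d\<close> and \<open>opp M d\<close>. The orientation of the
  surface is carried by \<open>left\<close>: \<open>left M d = Some \<phi>\<close> means that \<open>\<phi>\<close> is the face to the left of \<open>d\<close>,
  and \<open>None\<close> that \<open>d\<close> has the boundary of the surface on its left. If \<open>d\<close> has a left face, then
  \<open>nxt M d\<close> is the dart following \<open>d\<close> on the boundary of that face, traversed counterclockwise.
  Cells may be infinite in number, and an edge or a face may be glued to itself (loops, multiple
  edges and an edge with the same face on both sides are allowed).
\<close>

record ('v, 'e, 'f) surface =
  verts :: "'v set"
  darts :: "'e set"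
  faces :: "'f set"
  orig :: "'e \<Rightarrow> 'v"
  opp :: "'e \<Rightarrow> 'e"
  left :: "'e \<Rightarrow> 'f option"
  nxt :: "'e \<Rightarrow> 'e"

definition dest :: "('v, 'e, 'f) surface \<Rightarrow> 'e \<Rightarrow> 'v" where
  "dest M d = orig M (opp M d)"

definition right :: "('v, 'e, 'f) surface \<Rightarrow> 'e \<Rightarrow> 'f option" where
  "right M d = left M (opp M d)"

definition sides :: "('v, 'e, 'f) surface \<Rightarrow> 'e set" where
  "sides M = {d \<in> darts M. left M d \<noteq> None}"

definition out_darts :: "('v, 'e, 'f) surface \<Rightarrow> 'v \<Rightarrow> 'e set" where
  "out_darts M v = {d \<in> darts M. orig M d = v}"

text \<open>
  \<open>ccw M d d'\<close>: the darts \<open>d\<close> and \<open>d'\<close> leave the same vertex and bound a common corner there, which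
  lies to the left of \<open>d\<close> and to the right of \<open>d'\<close>.
\<close>

definition ccw :: "('v, 'e, 'f) surface \<Rightarrow> 'e \<Rightarrow> 'e \<Rightarrow> bool" where
  "ccw M d d' \<longleftrightarrow> d \<in> darts M \<and> d' \<in> darts M \<and> opp M d' \<in> sides M \<and> nxt M (opp M d') = d"

text \<open>
  The last two conditions on a vertex are the manifold condition. Since \<open>nxt M\<close> is a bijection of the
  sides, \<open>ccw M\<close> is a partial injection; on a finite set of darts which it connects it is therefore
  either one cycle (the vertex is interior) or one chain (the vertex lies on the boundary), that is,
  the link of the vertex is a circle or an arc.
\<close>

definition discrete_surface :: "('v, 'e, 'f) surface \<Rightarrow> bool" where
  "discrete_surface M \<longleftrightarrow>
     (\<forall>d \<in> darts M. orig M d \<in> verts M \<and> opp M d \<in> darts M \<and> opp M d \<noteq> d \<and> opp M (opp M d) = d \<and>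
        (left M d \<noteq> None \<or> right M d \<noteq> None)) \<and>
     bij_betw (nxt M) (sides M) (sides M) \<and>
     (\<forall>d \<in> sides M. the (left M d) \<in> faces M \<and> left M (nxt M d) = left M d \<and>
        orig M (nxt M d) = dest M d) \<and>
     (\<forall>\<phi> \<in> faces M. finite {d \<in> darts M. left M d = Some \<phi>} \<and> {d \<in> darts M. left M d = Some \<phi>} \<noteq> {} \<and>
        (\<forall>d \<in> darts M. \<forall>d' \<in> darts M. left M d = Some \<phi> \<and> left M d' = Some \<phi> \<longrightarrow>
           (\<exists>n. (nxt M ^^ n) d = d'))) \<and>
     (\<forall>v \<in> verts M. out_darts M v \<noteq> {} \<and> finite (out_darts M v) \<and>
        (\<forall>d \<in> out_darts M v. \<forall>d' \<in> out_darts M v. equivclp (ccw M) d d'))"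

text \<open>Oriented interior edges, and interior vertices.\<close>

definition int_darts :: "('v, 'e, 'f) surface \<Rightarrow> 'e set" where
  "int_darts M = {d \<in> darts M. left M d \<noteq> None \<and> right M d \<noteq> None}"

definition int_verts :: "('v, 'e, 'f) surface \<Rightarrow> 'v set" where
  "int_verts M = {v \<in> verts M. out_darts M v \<subseteq> int_darts M}"


section \<open>Simple connectedness\<close>

fun edge_path :: "('v, 'e, 'f) surface \<Rightarrow> 'v \<Rightarrow> 'e list \<Rightarrow> 'v \<Rightarrow> bool" where
  "edge_path M x [] y \<longleftrightarrow> x \<in> verts M \<and> x = y"
| "edge_path M x (d # p) y \<longleftrightarrow> d \<in> darts M \<and> orig M d = x \<and> edge_path M (dest M d) p y"

definition face_cycle :: "('v, 'e, 'f) surface \<Rightarrow> 'e \<Rightarrow> 'e list" where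
  "face_cycle M d =
     map (\<lambda>k. (nxt M ^^ k) d) [0..<card {d' \<in> darts M. left M d' = left M d}]"

text \<open>
  Homotopy of edge paths with fixed end points: a path may be changed by cancelling or inserting an
  edge traversed back and forth, or the full boundary of a face, started at any of its sides. The
  classes of closed paths at a vertex form the edge-path group of the cell complex, which is its
  fundamental group.
\<close>

inductive edge_homotopic :: "('v, 'e, 'f) surface \<Rightarrow> 'v \<Rightarrow> 'v \<Rightarrow> 'e list \<Rightarrow> 'e list \<Rightarrow> bool"
  for M x y where
  refl: "edge_path M x p y \<Longrightarrow> edge_homotopic M x y p p"
| sym: "edge_homotopic M x y p q \<Longrightarrow> edge_homotopic M x y q p"
| trans: "edge_homotopic M x y p q \<Longrightarrow> edge_homotopic M x y q r \<Longrightarrow> edge_homotopic M x y p r"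
| spur: "edge_path M x (p @ [d, opp M d] @ q) y \<Longrightarrow>
    edge_homotopic M x y (p @ [d, opp M d] @ q) (p @ q)"
| face: "edge_path M x (p @ face_cycle M d @ q) y \<Longrightarrow> d \<in> sides M \<Longrightarrow>
    edge_homotopic M x y (p @ face_cycle M d @ q) (p @ q)"

definition simply_connected_surface :: "('v, 'e, 'f) surface \<Rightarrow> bool" where
  "simply_connected_surface M \<longleftrightarrow>
     verts M \<noteq> {} \<and>
     (\<forall>x \<in> verts M. \<forall>y \<in> verts M. \<exists>p. edge_path M x p y) \<and>
     (\<forall>x p. edge_path M x p x \<longrightarrow> edge_homotopic M x x p [])"


section \<open>A-minimal and C-minimal surfaces\<close>

text \<open>
  A realization of \<open>M\<close> is a function on \<open>verts M\<close>, a realization of the dual \<open>M*\<close> a function on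
  \<open>faces M\<close>; values outside these sets play no role. An edge is represented by either of its darts.
\<close>

definition diff :: "('v, 'e, 'f) surface \<Rightarrow> ('v \<Rightarrow> real^3) \<Rightarrow> 'e \<Rightarrow> real^3" where
  "diff M N d = N (dest M d) - N (orig M d)"

definition dual_diff :: "('v, 'e, 'f) surface \<Rightarrow> ('f \<Rightarrow> real^3) \<Rightarrow> 'e \<Rightarrow> real^3" where
  "dual_diff M f d = f (the (left M d)) - f (the (right M d))"

definition admissible :: "('v, 'e, 'f) surface \<Rightarrow> ('v \<Rightarrow> real^3) \<Rightarrow> bool" where
  "admissible M N \<longleftrightarrow>
     (\<forall>v \<in> verts M. N v \<in> sphere 0 1) \<and> (\<forall>d \<in> darts M. N (orig M d) \<noteq> - N (dest M d))"

definition A_minimal ::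
    "('v, 'e, 'f) surface \<Rightarrow> ('v \<Rightarrow> real^3) \<Rightarrow> ('f \<Rightarrow> real^3) \<Rightarrow> bool" where
  "A_minimal M N f \<longleftrightarrow> admissible M N \<and>
     (\<forall>d \<in> int_darts M. cross3 (diff M N d) (dual_diff M f d) = 0 \<and>
        (N (orig M d) + N (dest M d)) \<bullet> dual_diff M f d = 0)"

text \<open>
  The dihedral angle at an edge with unit face normals \<open>n\<close>, \<open>n'\<close> and nonzero edge vector \<open>w\<close>. It is
  well defined if \<open>n\<close> and \<open>n'\<close> are orthogonal to \<open>w\<close> and \<open>n \<noteq> - n'\<close>.
\<close>

definition dihedral_angle :: "real^3 \<Rightarrow> real^3 \<Rightarrow> real^3 \<Rightarrow> real" where
  "dihedral_angle n n' w =
     (THE \<alpha>. - pi < \<alpha> \<and> \<alpha> < pi \<and> sin \<alpha> = cross3 n n' \<bullet> (w /\<^sub>R norm w) \<and> cos \<alpha> = n \<bullet> n')"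

definition planar_faces ::
    "('v, 'e, 'f) surface \<Rightarrow> ('v \<Rightarrow> real^3) \<Rightarrow> ('f \<Rightarrow> real^3) \<Rightarrow> bool" where
  "planar_faces M N g \<longleftrightarrow>
     (\<forall>d \<in> int_darts M. orthogonal (N (orig M d)) (dual_diff M g d) \<and>
        orthogonal (N (dest M d)) (dual_diff M g d))"

definition mean_curvature ::
    "('v, 'e, 'f) surface \<Rightarrow> ('v \<Rightarrow> real^3) \<Rightarrow> ('f \<Rightarrow> real^3) \<Rightarrow> 'v \<Rightarrow> real" where
  "mean_curvature M N g i =
     (\<Sum>d \<in> out_darts M i.
        if dual_diff M g d = 0 then 0
        else norm (dual_diff M g d) *
          tan (dihedral_angle (N (orig M d)) (N (dest M d)) (dual_diff M g d) / 2))"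

definition C_minimal ::
    "('v, 'e, 'f) surface \<Rightarrow> ('v \<Rightarrow> real^3) \<Rightarrow> ('f \<Rightarrow> real^3) \<Rightarrow> bool" where
  "C_minimal M N g \<longleftrightarrow> admissible M N \<and> planar_faces M N g \<and>
     (\<forall>i \<in> int_verts M. mean_curvature M N g i = 0)"

end

theory Submission
  imports Defs "HOL-Combinatorics.Orbits"
begin

text \<open>
  Let \<open>n\<close>, \<open>n'\<close> be the normals at the ends of an edge. The equations \<open>(n' - n) \<times> w = 0\<close> and
  \<open>(n + n') \<bullet> w = 0\<close> of an A-minimal edge vector \<open>w\<close> are equivalent to saying that
  \<open>u = n \<times> w = n' \<times> w\<close> is orthogonal to \<open>n\<close> and \<open>n'\<close> and that
  \<open>w = - (n + n') \<times> u / (1 + n \<bullet> n')\<close>. The passage between A-minimal and C-minimal surfaces is this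
  invertible correspondence, applied edge by edge. The mean curvature enters through the identity
  \<open>\<bar>u\<bar> tan (\<alpha>/2) = - n \<bullet> w\<close> (\<open>bend_term_eq\<close>): around an interior vertex \<open>i\<close>, the sum of the
  vectors \<open>w\<close> has the normal component \<open>- H\<^sub>i\<close>, while its tangential part is determined by
  \<open>N\<^sub>i \<times> \<Sum> w = \<Sum> u\<close>. Hence the \<open>w\<close> sum to zero around \<open>i\<close> exactly if the \<open>u\<close> do and the mean
  curvature vanishes. If \<open>w\<close> comes from a surface, it sums to zero around \<open>i\<close>, and so \<open>u\<close> does
  as well and \<open>H\<^sub>i = 0\<close>; if \<open>u\<close> comes from a C-minimal surface, both conditions hold and \<open>w\<close> sums to
  zero.

  It remains to integrate: on a simply connected surface, an antisymmetric function \<open>\<eta>\<close> on the interior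
  darts whose sum around each interior vertex vanishes is the differential of a function on the faces
  (\<open>dual_closed_form_exact\<close>). Since simple connectedness speaks of paths of primal edges, \<open>\<eta>\<close> is
  first turned into a form \<open>\<omega>\<close> on these. A corner is represented by the side that leaves it along its
  face. Turning around a single vertex, \<open>\<eta>\<close> has a potential \<open>\<rho>\<close> on the corners there
  (\<open>corner_potential\<close>); this is where the sum condition enters. On a side \<open>d\<close> put
  \<open>\<omega> d = \<rho> d - \<rho> (nxt d)\<close>, the discrepancy of the potentials at its two ends, compared within the
  face on the left. The face on the right gives the same discrepancy, and \<open>\<omega>\<close> telescopes to zero
  along a face, so \<open>\<omega>\<close> is the differential of a function \<open>h\<close> on the vertices
  (\<open>closed_form_exact\<close>). The constants \<open>h\<close> adjust the local potentials so that \<open>h + \<rho>\<close> takes the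
  same value at all corners of a face, and this value is the required function on the faces.
\<close>

section \<open>Incidence in a discrete surface\<close>

lemma dartD:
  assumes "discrete_surface M" and "d \<in> darts M"
  shows "orig M d \<in> verts M" "opp M d \<in> darts M" "opp M (opp M d) = d" "dest M d \<in> verts M"
    "left M d \<noteq> None \<or> right M d \<noteq> None"
    "orig M (opp M d) = dest M d" "dest M (opp M d) = orig M d"
    "left M (opp M d) = right M d" "right M (opp M d) = left M d"
proof -
  have d: "orig M d \<in> verts M \<and> opp M d \<in> darts M \<and> opp M (opp M d) = d \<and>
      (left M d \<noteq> None \<or> right M d \<noteq> None)" if "d \<in> darts M" for d
    using that assms(1) unfolding discrete_surface_def by blast
  show "orig M d \<in> verts M" "opp M d \<in> darts M" "opp M (opp M d) = d" "dest M d \<in> verts M"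
    "left M d \<noteq> None \<or> right M d \<noteq> None"
    "orig M (opp M d) = dest M d" "dest M (opp M d) = orig M d"
    "left M (opp M d) = right M d" "right M (opp M d) = left M d"
    using d[OF assms(2)] d[of "opp M d"] by (auto simp: dest_def right_def)
qed

lemma nxt_bij: "discrete_surface M \<Longrightarrow> bij_betw (nxt M) (sides M) (sides M)"
  unfolding discrete_surface_def by blast

lemma sideD:
  assumes "discrete_surface M" and "d \<in> sides M"
  shows "d \<in> darts M" "left M d \<noteq> None" "the (left M d) \<in> faces M" "nxt M d \<in> sides M"
    "left M (nxt M d) = left M d" "orig M (nxt M d) = dest M d"
proof -
  show "d \<in> darts M" "left M d \<noteq> None"
    using assms(2) by (auto simp: sides_def)
  show "the (left M d) \<in> faces M" "left M (nxt M d) = left M d" "orig M (nxt M d) = dest M d"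
    using assms unfolding discrete_surface_def by blast+
  show "nxt M d \<in> sides M"
    using nxt_bij[OF assms(1)] assms(2) by (auto simp: bij_betw_def)
qed

lemma face_transitive:
  assumes "discrete_surface M" and "d \<in> sides M" and "d' \<in> sides M" and "left M d = left M d'"
  shows "\<exists>n. (nxt M ^^ n) d = d'"
proof -
  obtain \<phi> where \<phi>: "left M d = Some \<phi>"
    using assms(2) by (auto simp: sides_def)
  have "\<phi> \<in> faces M"
    using sideD(3)[OF assms(1,2)] \<phi> by simp
  then show ?thesis
    using assms \<phi> unfolding discrete_surface_def sides_def by (metis (no_types, lifting) mem_Collect_eq)
qed

lemma vertD:
  assumes "discrete_surface M" and "v \<in> verts M"
  shows "out_darts M v \<noteq> {}" "finite (out_darts M v)"
    "\<And>d d'. d \<in> out_darts M v \<Longrightarrow> d' \<in> out_darts M v \<Longrightarrow> equivclp (ccw M) d d'"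
  using assms unfolding discrete_surface_def by blast+

lemma int_dartD:
  assumes "discrete_surface M" and "d \<in> int_darts M"
  shows "d \<in> darts M" "d \<in> sides M" "opp M d \<in> sides M" "opp M d \<in> int_darts M"
  using assms(2) dartD[OF assms(1), of d] by (auto simp: int_darts_def sides_def)

lemma out_dartsD:
  assumes "v \<in> int_verts M" "d \<in> out_darts M v"
  shows "d \<in> int_darts M" "orig M d = v"
proof -
  show "d \<in> int_darts M"
    using assms unfolding int_verts_def by blast
  show "orig M d = v"
    using assms(2) by (simp add: out_darts_def)
qed

text \<open>
  \<open>nxt M\<close> permutes the sides of a face transitively, so they form one orbit, and the number of
  sides, which is the length of \<open>face_cycle\<close>, is the period.
\<close>

lemma face_cycle_closes:
  assumes "discrete_surface M" and "d \<in> sides M"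
  shows "(nxt M ^^ card {d' \<in> darts M. left M d' = left M d}) d = d"
proof -
  let ?A = "{d' \<in> darts M. left M d' = left M d}"
  have A: "?A = {d' \<in> sides M. left M d' = left M d}"
    using assms by (auto simp: sides_def)
  have nA: "(nxt M ^^ n) d \<in> ?A" for n
    by (induction n) (use A assms sideD[OF assms(1)] in auto)
  obtain n where "(nxt M ^^ n) (nxt M d) = d"
    using face_transitive[OF assms(1) sideD(4)[OF assms] assms(2)] sideD(5)[OF assms] by blast
  then have "(nxt M ^^ Suc n) d = d"
    by (simp add: funpow_swap1)
  then have self: "d \<in> orbit (nxt M) d"
    unfolding orbit_altdef by (metis (mono_tags, lifting) mem_Collect_eq zero_less_Suc)
  have "orbit (nxt M) d = ?A"
  proof
    show "orbit (nxt M) d \<subseteq> ?A"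
      using nA unfolding orbit_altdef by blast
    show "?A \<subseteq> orbit (nxt M) d"
    proof
      fix d' assume "d' \<in> ?A"
      then obtain m where "(nxt M ^^ m) d = d'"
        using face_transitive[OF assms(1,2), of d'] A by auto
      then show "d' \<in> orbit (nxt M) d"
        using self by (metis funpow_in_orbit)
    qed
  qed
  then have "card ?A = funpow_dist1 (nxt M) d d"
    using orbit_conv_funpow_dist1[OF self] inj_on_funpow_dist1[OF self] 
    by (metis card_atLeastLessThan card_image diff_zero)
  then show ?thesis
    using funpow_dist1_prop[OF self] by simp
qed

text \<open>
  If \<open>d\<close> leaves the vertex \<open>v\<close>, then \<open>nxt M (opp M d)\<close> is the next dart leaving \<open>v\<close> in clockwise
  direction: the corner to the left of \<open>d\<close> and the one to the left of \<open>nxt M (opp M d)\<close> are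
  separated by \<open>d\<close>. This map describes how the corners at \<open>v\<close> are arranged.
\<close>

lemma clockwise_step:
  assumes "discrete_surface M" and "d \<in> darts M" and "right M d \<noteq> None"
  shows "nxt M (opp M d) \<in> sides M" "left M (nxt M (opp M d)) = right M d"
    "orig M (nxt M (opp M d)) = orig M d"
proof -
  have "opp M d \<in> sides M"
    using assms dartD[OF assms(1,2)] by (simp add: sides_def)
  from sideD[OF assms(1) this] show "nxt M (opp M d) \<in> sides M" 
    "left M (nxt M (opp M d)) = right M d" "orig M (nxt M (opp M d)) = orig M d"
    using dartD[OF assms(1,2)] by auto
qed

lemma clockwise_step_inj:
  assumes "discrete_surface M"
  shows "inj_on (\<lambda>d. nxt M (opp M d)) {d \<in> darts M. right M d \<noteq> None}"
proof (rule inj_onI)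
  fix d d' assume a: "d \<in> {d \<in> darts M. right M d \<noteq> None}" "d' \<in> {d \<in> darts M. right M d \<noteq> None}"
    and eq: "nxt M (opp M d) = nxt M (opp M d')"
  have "opp M d \<in> sides M" "opp M d' \<in> sides M"
    using a dartD[OF assms] by (auto simp: sides_def)
  then have "opp M d = opp M d'"
    using eq nxt_bij[OF assms] by (auto simp: bij_betw_def inj_on_def)
  then show "d = d'"
    using a dartD(3)[OF assms] by (metis (mono_tags, lifting) mem_Collect_eq)
qed

lemma clockwise_step_permutes:
  assumes "discrete_surface M" and "v \<in> verts M" and "\<And>d. d \<in> out_darts M v \<Longrightarrow> right M d \<noteq> None"
  shows "bij_betw (\<lambda>d. nxt M (opp M d)) (out_darts M v) (out_darts M v)"
proof -
  let ?\<sigma> = "\<lambda>d. nxt M (opp M d)" and ?S = "out_darts M v"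
  have S: "d \<in> darts M \<and> right M d \<noteq> None \<and> orig M d = v" if "d \<in> ?S" for d
    using that assms(3) by (simp add: out_darts_def)
  have "?\<sigma> d \<in> ?S" if "d \<in> ?S" for d
    using S[OF that] clockwise_step[OF assms(1), of d] sideD(1)[OF assms(1), of "?\<sigma> d"]
    by (simp add: out_darts_def)
  moreover have "inj_on ?\<sigma> ?S"
    by (rule inj_on_subset[OF clockwise_step_inj[OF assms(1)]]) (use S in blast)
  ultimately show ?thesis
    using vertD(2)[OF assms(1,2)] by (simp add: bij_betw_def endo_inj_surj image_subset_iff)
qed

section \<open>Closed forms on primal edges\<close>

lemma edge_path_append:
  "edge_path M x (p @ q) y \<longleftrightarrow> (\<exists>z. edge_path M x p z \<and> edge_path M z q y)"
  if "discrete_surface M"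
proof (induction p arbitrary: x)
  case Nil
  have "edge_path M x q y \<Longrightarrow> x \<in> verts M"
    by (cases q) (auto dest: dartD[OF that])
  then show ?case by auto
next
  case (Cons a p)
  then show ?case by auto
qed

lemma edge_path_rev:
  assumes "discrete_surface M" and "edge_path M x p y"
  shows "edge_path M y (rev (map (opp M) p)) x"
  using assms(2)
proof (induction p arbitrary: x)
  case (Cons d p)
  then have "edge_path M y (rev (map (opp M) p)) (dest M d)" "d \<in> darts M" "orig M d = x"
    by auto
  moreover have "edge_path M (dest M d) [opp M d] x"
    using dartD[OF assms(1) \<open>d \<in> darts M\<close>] \<open>orig M d = x\<close> by simp
  ultimately show ?case
    by (auto simp: edge_path_append[OF assms(1)])
qed auto

lemma edge_path_darts: "edge_path M x p y \<Longrightarrow> set p \<subseteq> darts M"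
  by (induction p arbitrary: x) auto

lemma sum_rev_path:
  fixes \<omega> :: "'e \<Rightarrow> 'a::ab_group_add"
  assumes "\<And>d. d \<in> darts M \<Longrightarrow> \<omega> (opp M d) = - \<omega> d" and "set p \<subseteq> darts M"
  shows "sum_list (map \<omega> (rev (map (opp M) p))) = - sum_list (map \<omega> p)"
  using assms(2) by (induction p) (auto simp: assms(1))

lemma sum_homotopy_invariant:
  fixes \<omega> :: "'e \<Rightarrow> 'a::ab_group_add"
  assumes "edge_homotopic M x y p q"
    and "\<And>d. d \<in> darts M \<Longrightarrow> \<omega> (opp M d) = - \<omega> d"
    and "\<And>d. d \<in> sides M \<Longrightarrow> sum_list (map \<omega> (face_cycle M d)) = 0"
  shows "sum_list (map \<omega> p) = sum_list (map \<omega> q)"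
  using assms(1)
proof induction
  case (spur p d q)
  then have "d \<in> darts M"
    using edge_path_darts by fastforce
  then show ?case by (simp add: assms(2))
next
  case (face p d q)
  then show ?case by (simp add: assms(3))
qed auto

text \<open>
  The usual integration from a base point: two paths with the same ends form a null-homotopic closed
  path, so the integral depends on the end point only.
\<close>

lemma closed_form_exact:
  fixes \<omega> :: "'e \<Rightarrow> 'a::ab_group_add"
  assumes M: "discrete_surface M" "simply_connected_surface M"
    and opp: "\<And>d. d \<in> darts M \<Longrightarrow> \<omega> (opp M d) = - \<omega> d"
    and face: "\<And>d. d \<in> sides M \<Longrightarrow> sum_list (map \<omega> (face_cycle M d)) = 0"
  shows "\<exists>h. \<forall>d \<in> darts M. h (dest M d) = h (orig M d) + \<omega> d"
proof -
  obtain b where b: "b \<in> verts M"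
    using M(2) by (auto simp: simply_connected_surface_def)
  have unique: "sum_list (map \<omega> p) = sum_list (map \<omega> q)"
    if "edge_path M b p y" "edge_path M b q y" for p q y
  proof -
    have "edge_path M b (p @ rev (map (opp M) q)) b"
      using that edge_path_rev[OF M(1)] edge_path_append[OF M(1)] by blast
    then have "edge_homotopic M b b (p @ rev (map (opp M) q)) []"
      using M(2) b by (auto simp: simply_connected_surface_def)
    from sum_homotopy_invariant[OF this opp face]
    have "sum_list (map \<omega> p) + sum_list (map \<omega> (rev (map (opp M) q))) = 0"
      by simp
    then show ?thesis
      using sum_rev_path[where M = M and \<omega> = \<omega>, OF opp edge_path_darts[OF that(2)]] by simp
  qed
  define P where "P y = (SOME p. edge_path M b p y)" for y
  have P: "edge_path M b (P y) y" if "y \<in> verts M" for y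
  proof -
    have "\<exists>p. edge_path M b p y"
      using M(2) b that unfolding simply_connected_surface_def by blast
    then show ?thesis unfolding P_def by (rule someI_ex)
  qed
  have "sum_list (map \<omega> (P (dest M d))) = sum_list (map \<omega> (P (orig M d))) + \<omega> d"
    if d: "d \<in> darts M" for d
  proof -
    have "edge_path M (orig M d) [d] (dest M d)"
      using dartD[OF M(1) d] d by simp
    then have "edge_path M b (P (orig M d) @ [d]) (dest M d)"
      using P[of "orig M d"] dartD(1)[OF M(1) d] edge_path_append[OF M(1)] by blast
    from unique[OF P[OF dartD(4)[OF M(1) d]] this] show ?thesis by simp
  qed
  then show ?thesis
    by (intro exI[of _ "\<lambda>y. sum_list (map \<omega> (P y))"]) blast
qed

section \<open>Closed forms on dual edges\<close>

text \<open>
  This is integration around one vertex, \<open>S\<close> being the darts that leave it, \<open>\<sigma>\<close> the clockwise step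
  and \<open>D\<close> the darts where it is defined. The assumption \<open>conn\<close> says that \<open>\<sigma>\<close> connects \<open>S\<close>. If
  \<open>D \<noteq> S\<close>, then \<open>S\<close> is a chain ending in the only point outside \<open>D\<close>; if \<open>D = S\<close>, it is a cycle, and
  the last step around it is consistent because \<open>\<eta>\<close> has sum zero. Both cases are treated
  alike by summing \<open>\<eta>\<close> along \<open>\<sigma>\<close> up to a point \<open>z\<close> that all of \<open>S\<close> reaches.
\<close>

lemma potential_along_partial_injection:
  fixes \<eta> :: "'e \<Rightarrow> 'a::ab_group_add"
  assumes fin: "finite S" "S \<noteq> {}" and D: "D \<subseteq> S" and \<sigma>: "\<sigma> ` D \<subseteq> S" "inj_on \<sigma> D"
    and conn: "\<And>R. R \<subseteq> S \<Longrightarrow> R \<noteq> {} \<Longrightarrow> (\<And>x. x \<in> D \<Longrightarrow> x \<in> R \<longleftrightarrow> \<sigma> x \<in> R) \<Longrightarrow> R = S"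
    and closed: "D = S \<Longrightarrow> sum \<eta> S = 0"
  shows "\<exists>\<rho>. \<forall>x \<in> D. \<rho> x = \<rho> (\<sigma> x) + \<eta> x"
proof -
  obtain z where z: "z \<in> S" "D \<noteq> S \<Longrightarrow> z \<notin> D"
    using fin(2) D by blast
  define R where "R = {x \<in> S. \<exists>n. (\<sigma> ^^ n) x = z}"
  have bwd: "x \<in> R" if "x \<in> D" "\<sigma> x \<in> R" for x
    using that D unfolding R_def by (auto simp flip: funpow_swap1 intro: exI[of _ "Suc _"])
  have fwd0: "\<sigma> x \<in> R" if x: "x \<in> D" "x \<in> R" "x \<noteq> z" for x
  proof -
    obtain n where n: "(\<sigma> ^^ n) x = z" using x(2) by (auto simp: R_def)
    then obtain m where "n = Suc m" using x(3) by (cases n) auto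
    then show ?thesis using n x \<sigma>(1) by (auto simp: R_def funpow_swap1)
  qed
  have fwd: "\<sigma> x \<in> R" if x: "x \<in> D" "x \<in> R" for x
  proof (cases "D = S")
    case False
    then show ?thesis using x z fwd0 by blast
  next
    case True
    \<comment> \<open>The complement of \<open>R\<close> is mapped into itself, hence onto itself, so nothing in \<open>R\<close> can be
        mapped there.\<close>
    have "\<sigma> ` (S - R) \<subseteq> S - R"
      using True bwd \<sigma>(1) by blast
    moreover have "inj_on \<sigma> (S - R)"
      using \<sigma>(2) True by (auto intro: inj_on_subset)
    ultimately have surj: "\<sigma> ` (S - R) = S - R"
      using fin(1) by (simp add: endo_inj_surj)
    show ?thesis
    proof (rule ccontr)
      assume "\<sigma> x \<notin> R"
      then have "\<sigma> x \<in> \<sigma> ` (S - R)" using surj \<sigma>(1) x by blast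
      then obtain y where "y \<in> S - R" "\<sigma> x = \<sigma> y" by blast
      then have "x = y" using \<sigma>(2) True x by (auto dest: inj_onD)
      then show False using x \<open>y \<in> S - R\<close> by blast
    qed
  qed
  have "z \<in> R"
    using z by (auto simp: R_def intro: exI[of _ 0])
  have RS: "R = S"
  proof (rule conn)
    show "R \<subseteq> S" by (auto simp: R_def)
    show "R \<noteq> {}" using \<open>z \<in> R\<close> by blast
    show "x \<in> R \<longleftrightarrow> \<sigma> x \<in> R" if "x \<in> D" for x
      using bwd fwd that by blast
  qed
  define len where "len x = (LEAST n. (\<sigma> ^^ n) x = z)" for x
  define \<rho> where "\<rho> x = (\<Sum>k<len x. \<eta> ((\<sigma> ^^ k) x))" for x
  have step: "\<rho> x = \<rho> (\<sigma> x) + \<eta> x" if x: "x \<in> D" "x \<noteq> z" for x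
  proof -
    obtain n where n: "(\<sigma> ^^ n) x = z"
      using x D RS by (auto simp: R_def)
    have "len x = Suc (len (\<sigma> x))"
      unfolding len_def using Least_Suc[of "\<lambda>n. (\<sigma> ^^ n) x = z", OF n] x(2)
      by (simp add: funpow_swap1)
    then show ?thesis
      unfolding \<rho>_def by (simp add: sum.lessThan_Suc_shift funpow_swap1 add.commute del: sum.lessThan_Suc)
  qed
  \<comment> \<open>The equation at \<open>z\<close> follows from the others: the sum over all of \<open>S\<close> of their defects vanishes.\<close>
  have "\<rho> z = \<rho> (\<sigma> z) + \<eta> z" if "z \<in> D"
  proof -
    have DS: "D = S" using z that by blast
    have bij: "\<sigma> ` S = S"
      using \<sigma> DS fin(1) by (simp add: endo_inj_surj)
    have "sum \<rho> S = (\<Sum>x\<in>S. \<rho> (\<sigma> x))"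
      using sum.reindex[of \<sigma> S \<rho>] \<sigma>(2) DS bij by simp
    then have "(\<Sum>x\<in>S. \<rho> x - \<rho> (\<sigma> x) - \<eta> x) = 0"
      using closed[OF DS] by (simp add: sum_subtractf)
    moreover have "(\<Sum>x\<in>S. \<rho> x - \<rho> (\<sigma> x) - \<eta> x) = \<rho> z - \<rho> (\<sigma> z) - \<eta> z"
      using step DS fin(1) z(1) by (subst sum.remove[of _ z]) (auto intro!: sum.neutral)
    ultimately show ?thesis by (simp add: algebra_simps)
  qed
  with step show ?thesis by blast
qed

text \<open>
  The value \<open>\<rho> d\<close> belongs to the corner to the left of \<open>d\<close>. At an interior vertex these corners form a
  cycle, on which the sum condition makes \<open>\<eta>\<close> integrable; at a boundary vertex they form a chain.
\<close>

lemma corner_potential: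
  fixes \<eta> :: "'e \<Rightarrow> 'a::ab_group_add"
  assumes M: "discrete_surface M"
    and closed: "\<And>v. v \<in> int_verts M \<Longrightarrow> (\<Sum>d \<in> out_darts M v. \<eta> d) = 0"
  shows "\<exists>\<rho>. \<forall>d \<in> int_darts M. \<rho> d = \<rho> (nxt M (opp M d)) + \<eta> d"
proof -
  let ?\<sigma> = "\<lambda>d. nxt M (opp M d)"
  have "\<exists>\<rho>. \<forall>d \<in> {d \<in> out_darts M v. right M d \<noteq> None}. \<rho> d = \<rho> (?\<sigma> d) + \<eta> d"
    if v: "v \<in> verts M" for v
  proof (rule potential_along_partial_injection[where S = "out_darts M v"])
    let ?D = "{d \<in> out_darts M v. right M d \<noteq> None}"
    show "finite (out_darts M v)" "out_darts M v \<noteq> {}" "?D \<subseteq> out_darts M v"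
      using vertD[OF M v] by auto
    show img: "?\<sigma> ` ?D \<subseteq> out_darts M v"
      using clockwise_step[OF M] sideD(1)[OF M] by (auto simp: out_darts_def)
    show inj: "inj_on ?\<sigma> ?D"
      by (rule inj_on_subset[OF clockwise_step_inj[OF M]]) (auto simp: out_darts_def)
    show "R = out_darts M v"
      if R: "R \<subseteq> out_darts M v" "R \<noteq> {}" "\<And>d. d \<in> ?D \<Longrightarrow> d \<in> R \<longleftrightarrow> ?\<sigma> d \<in> R" for R
    proof
      obtain r where r: "r \<in> R" using R(2) by blast
      have ccw: "a \<in> R \<longleftrightarrow> b \<in> R" if ab: "ccw M a b" for a b
      proof -
        have b: "b \<in> darts M" "right M b \<noteq> None" "a = ?\<sigma> b"
          using ab by (auto simp: ccw_def sides_def right_def)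
        then have "orig M a = orig M b"
          using clockwise_step(3)[OF M] by blast
        then show ?thesis
          using R b by (cases "orig M b = v") (auto simp: out_darts_def)
      qed
      show "out_darts M v \<subseteq> R"
      proof
        fix d assume "d \<in> out_darts M v"
        then have "equivclp (ccw M) r d"
          using vertD(3)[OF M v] r R(1) by blast
        then show "d \<in> R"
          by (induction rule: equivclp_induct) (use r ccw in blast)+
      qed
    qed (use R in blast)
    \<comment> \<open>If every dart at \<open>v\<close> has a right face, the step is a permutation with values in the sides, so
        every dart at \<open>v\<close> has a left face too.\<close>
    show "sum \<eta> (out_darts M v) = 0" if full: "?D = out_darts M v"
    proof (rule closed)
      have right: "right M d \<noteq> None" if "d \<in> out_darts M v" for d
        using full that by blast
      have "?\<sigma> ` out_darts M v = out_darts M v"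
        using clockwise_step_permutes[OF M v right] by (simp add: bij_betw_def)
      moreover have "?\<sigma> ` out_darts M v \<subseteq> sides M"
      proof
        fix c assume "c \<in> ?\<sigma> ` out_darts M v"
        then obtain d where "c = ?\<sigma> d" "d \<in> ?D" using full by blast
        then show "c \<in> sides M" using clockwise_step(1)[OF M] by (simp add: out_darts_def)
      qed
      ultimately have left: "out_darts M v \<subseteq> sides M" by simp
      show "v \<in> int_verts M"
        using v left right by (auto simp: int_verts_def int_darts_def sides_def)
    qed
  qed
  then obtain \<rho> where \<rho>: "\<And>v d. v \<in> verts M \<Longrightarrow> d \<in> out_darts M v \<Longrightarrow> right M d \<noteq> None \<Longrightarrow>
      \<rho> v d = \<rho> v (?\<sigma> d) + \<eta> d"
    by (atomize_elim, intro choice) blast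
  have "\<rho> (orig M d) d = \<rho> (orig M (?\<sigma> d)) (?\<sigma> d) + \<eta> d" if "d \<in> int_darts M" for d
    using \<rho>[of "orig M d" d] that dartD(1)[OF M, of d] clockwise_step(3)[OF M, of d]
    by (auto simp: int_darts_def out_darts_def)
  then show ?thesis
    by (intro exI[of _ "\<lambda>d. \<rho> (orig M d) d"]) blast
qed

lemma dual_closed_form_exact:
  fixes M :: "('v, 'e, 'f) surface" and \<eta> :: "'e \<Rightarrow> real^3"
  assumes M: "discrete_surface M" "simply_connected_surface M"
    and opp: "\<And>d. d \<in> int_darts M \<Longrightarrow> \<eta> (opp M d) = - \<eta> d"
    and closed: "\<And>v. v \<in> int_verts M \<Longrightarrow> (\<Sum>d \<in> out_darts M v. \<eta> d) = 0"
  shows "\<exists>g. \<forall>d \<in> int_darts M. dual_diff M g d = \<eta> d"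
proof -
  obtain \<rho> where \<rho>: "\<And>d. d \<in> int_darts M \<Longrightarrow> \<rho> d = \<rho> (nxt M (opp M d)) + \<eta> d"
    using corner_potential[where \<eta> = \<eta>, OF M(1) closed] by blast
  \<comment> \<open>A dart with the boundary on its left takes the negative of the value at the opposite side.\<close>
  define \<omega> where "\<omega> d = (if left M d \<noteq> None then \<rho> d - \<rho> (nxt M d)
      else \<rho> (nxt M (opp M d)) - \<rho> (opp M d))" for d
  have anti: "\<omega> (opp M d) = - \<omega> d" if d: "d \<in> darts M" for d
  proof (cases "d \<in> int_darts M")
    case True
    then have "\<rho> d = \<rho> (nxt M (opp M d)) + \<eta> d" "\<rho> (opp M d) = \<rho> (nxt M d) - \<eta> d"
      using \<rho>[of d] \<rho>[of "opp M d"] opp[of d] int_dartD(4)[OF M(1)] dartD(3)[OF M(1) d] by auto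
    then show ?thesis
      using True dartD[OF M(1) d] by (simp add: \<omega>_def int_darts_def)
  next
    case False
    then show ?thesis
      using dartD[OF M(1) d] d by (auto simp: \<omega>_def int_darts_def)
  qed
  have \<omega>_side: "\<omega> d = \<rho> d - \<rho> (nxt M d)" if "d \<in> sides M" for d
    using that by (simp add: \<omega>_def sides_def)
  have face: "sum_list (map \<omega> (face_cycle M d)) = 0" if d: "d \<in> sides M" for d
  proof -
    have side: "(nxt M ^^ k) d \<in> sides M" for k
      by (induction k) (use d sideD(4)[OF M(1)] in auto)
    have "sum_list (map \<omega> (map (\<lambda>k. (nxt M ^^ k) d) [0..<n])) = \<rho> d - \<rho> ((nxt M ^^ n) d)" for n
      by (induction n) (auto simp: \<omega>_side[OF side])
    then show ?thesis
      unfolding face_cycle_def using face_cycle_closes[OF M(1) d] by simp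
  qed
  obtain h where h: "\<And>d. d \<in> darts M \<Longrightarrow> h (dest M d) = h (orig M d) + \<omega> d"
    using closed_form_exact[where \<omega> = \<omega>, OF M anti face] by blast
  define G where "G d = h (orig M d) + \<rho> d" for d
  have G_nxt: "G (nxt M d) = G d" if "d \<in> sides M" for d
    using h[of d] \<omega>_side[OF that] sideD[OF M(1) that] by (simp add: G_def)
  have G_face: "G d = G d'" if dd: "d \<in> sides M" "d' \<in> sides M" "left M d = left M d'" for d d'
  proof -
    obtain n where n: "(nxt M ^^ n) d = d'"
      using face_transitive[OF M(1) dd] by blast
    have "(nxt M ^^ k) d \<in> sides M \<and> G ((nxt M ^^ k) d) = G d" for k
      by (induction k) (use dd G_nxt sideD(4)[OF M(1)] in auto)
    then show ?thesis using n by metis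
  qed
  define g where "g \<phi> = G (SOME d. d \<in> sides M \<and> left M d = Some \<phi>)" for \<phi>
  have g: "g (the (left M d)) = G d" if d: "d \<in> sides M" for d
  proof -
    define e where "e = (SOME e. e \<in> sides M \<and> left M e = Some (the (left M d)))"
    have left: "left M d = Some (the (left M d))"
      using sideD(2)[OF M(1) d] by simp
    have "e \<in> sides M \<and> left M e = Some (the (left M d))"
      unfolding e_def by (rule someI[of _ d]) (use d left in simp)
    then have "G e = G d"
      using d left by (intro G_face) simp_all
    then show ?thesis
      by (simp add: g_def e_def)
  qed
  have "dual_diff M g d = \<eta> d" if d: "d \<in> int_darts M" for d
  proof -
    let ?c = "nxt M (opp M d)"
    have c: "?c \<in> sides M" "left M ?c = right M d" "orig M ?c = orig M d"
      using clockwise_step[OF M(1), of d] d by (auto simp: int_darts_def)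
    have "dual_diff M g d = G d - G ?c"
      using g[OF int_dartD(2)[OF M(1) d]] g[OF c(1)] c(2) by (simp add: dual_diff_def)
    then show ?thesis
      using \<rho>[OF d] c(3) by (simp add: G_def)
  qed
  then show ?thesis by blast
qed

text \<open>
  The clockwise step permutes the darts at an interior vertex and carries left faces to right faces, so
  the two parts of the sum cancel.
\<close>

lemma sum_dual_diff_eq_0:
  assumes M: "discrete_surface M" and v: "v \<in> int_verts M"
  shows "(\<Sum>d \<in> out_darts M v. dual_diff M f d) = 0"
proof -
  let ?\<sigma> = "\<lambda>d. nxt M (opp M d)" and ?S = "out_darts M v"
  have S: "d \<in> darts M" "right M d \<noteq> None" if "d \<in> ?S" for d
    using out_dartsD(1)[OF v that] by (simp_all add: int_darts_def)
  have "bij_betw ?\<sigma> ?S ?S"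
    using clockwise_step_permutes[OF M _ S(2)] v by (simp add: int_verts_def)
  then have "(\<Sum>d\<in>?S. f (the (left M d))) = (\<Sum>d\<in>?S. f (the (left M (?\<sigma> d))))"
    by (rule sum.reindex_bij_betw[symmetric])
  also have "\<dots> = (\<Sum>d\<in>?S. f (the (right M d)))"
    by (rule sum.cong) (simp_all add: clockwise_step(2)[OF M S])
  finally show ?thesis
    by (simp add: dual_diff_def sum_subtractf)
qed

section \<open>Geometry of a single edge\<close>

lemma cross3_sum_right: "cross3 x (\<Sum>a\<in>A. f a) = (\<Sum>a\<in>A. cross3 x (f a))"
  by (rule linear_sum) (auto intro!: linearI simp: cross_add_right cross_mult_right)

lemma unit_inner_neq_minus_1:
  fixes n n' :: "real^3"
  assumes "norm n = 1" "norm n' = 1" "n \<noteq> - n'"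
  shows "1 + n \<bullet> n' \<noteq> 0"
proof
  assume "1 + n \<bullet> n' = 0"
  then have "(n + n') \<bullet> (n + n') = 0"
    using assms by (simp add: inner_add_left inner_add_right inner_commute norm_eq_1)
  then show False
    using assms(3) by (simp add: eq_neg_iff_add_eq_0)
qed

text \<open>
  The formula is \<open>tan (\<alpha>/2) = sin \<alpha> / (1 + cos \<alpha>)\<close>. That the defining description of the angle has a
  solution needs \<open>sin\<^sup>2 \<alpha> + cos\<^sup>2 \<alpha> = 1\<close>, which holds because \<open>n \<times> n'\<close> is parallel to
  \<open>w\<close>; the solution is then \<open>2 arctan (s / (1 + c))\<close>, and the half angle formula shows that there is
  no other.
\<close>

lemma norm_mult_tan_half_dihedral_angle:
  fixes n n' w :: "real^3"
  assumes n: "norm n = 1" "norm n' = 1" "n \<noteq> - n'" and w: "n \<bullet> w = 0" "n' \<bullet> w = 0" "w \<noteq> 0"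
  shows "norm w * tan (dihedral_angle n n' w / 2) = (cross3 n n' \<bullet> w) / (1 + n \<bullet> n')"
proof -
  define s where "s = cross3 n n' \<bullet> (w /\<^sub>R norm w)"
  define c where "c = n \<bullet> n'"
  have c: "1 + c \<noteq> 0"
    using unit_inner_neq_minus_1[OF n] by (simp add: c_def)
  have "cross3 (cross3 n n') w = 0"
    using w by (subst cross_skew) (simp add: Lagrange inner_commute)
  then have "(cross3 n n' \<bullet> w)\<^sup>2 = (norm (cross3 n n'))\<^sup>2 * (norm w)\<^sup>2"
    using norm_and_cross_eq_0[of "cross3 n n'" w] norm_cross_dot[of "cross3 n n'" w]
    by (simp add: power_mult_distrib)
  then have "s\<^sup>2 = (norm (cross3 n n'))\<^sup>2"
    using w(3) by (simp add: s_def power_mult_distrib power_inverse field_simps)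
  then have circle: "c\<^sup>2 + s\<^sup>2 = 1"
    using norm_cross_dot[of n n'] n by (simp add: c_def)
  define t where "t = s / (1 + c)"
  have "t\<^sup>2 = (1 - c) / (1 + c)"
  proof -
    have "s\<^sup>2 = (1 - c) * (1 + c)"
      using circle by (simp add: power2_eq_square algebra_simps)
    then show ?thesis
      using c by (simp add: t_def power_divide power2_eq_square)
  qed
  then have t2: "1 + t\<^sup>2 = 2 / (1 + c)" "1 - t\<^sup>2 = 2 * c / (1 + c)"
    using c by (simp_all add: field_simps)
  have "dihedral_angle n n' w = 2 * arctan t"
    unfolding dihedral_angle_def s_def[symmetric] c_def[symmetric]
  proof (rule the_equality)
    have "sin (2 * arctan t) = s" "cos (2 * arctan t) = c"
      using c t2 by (simp_all add: sin_tan_half cos_tan_half tan_arctan t_def)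
    then show "- pi < 2 * arctan t \<and> 2 * arctan t < pi \<and> sin (2 * arctan t) = s \<and> cos (2 * arctan t) = c"
      using arctan_bounded[of t] by simp
  next
    fix \<alpha> assume \<alpha>: "- pi < \<alpha> \<and> \<alpha> < pi \<and> sin \<alpha> = s \<and> cos \<alpha> = c"
    then have "tan (\<alpha> / 2) = t"
      using tan_half[of "\<alpha> / 2"] by (simp add: t_def add.commute)
    then have "arctan t = \<alpha> / 2"
      using \<alpha> by (intro arctan_unique) auto
    then show "\<alpha> = 2 * arctan t" by simp
  qed
  then have "tan (dihedral_angle n n' w / 2) = s / (1 + c)"
    by (simp add: tan_arctan t_def)
  then show ?thesis
    using w(3) by (simp add: s_def c_def)
qed

text \<open>
  The link between the two kinds of surfaces. Writing \<open>u = n \<times> w\<close>, one has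
  \<open>(n \<times> n') \<bullet> u = n' \<bullet> w - (n \<bullet> n') (n \<bullet> w)\<close>, and \<open>n' \<bullet> w = - n \<bullet> w\<close>, so that the
  factor \<open>1 + n \<bullet> n'\<close> cancels.
\<close>

lemma bend_term_eq:
  fixes n n' w u :: "real^3"
  assumes n: "norm n = 1" "norm n' = 1" "n \<noteq> - n'"
    and w: "(n + n') \<bullet> w = 0" and u: "u = cross3 n w" "u = cross3 n' w"
  shows "(if u = 0 then 0 else norm u * tan (dihedral_angle n n' u / 2)) = - (n \<bullet> w)"
proof (cases "u = 0")
  case True
  \<comment> \<open>Here \<open>w\<close> is a multiple of \<open>n\<close>; being orthogonal to \<open>n + n'\<close>, it has to vanish.\<close>
  have c: "1 + n \<bullet> n' \<noteq> 0" by (rule unit_inner_neq_minus_1[OF n])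
  have "cross3 n (cross3 n w) = 0" using u True by simp
  then have w1: "w = (n \<bullet> w) *\<^sub>R n"
    using n by (simp add: Lagrange norm_eq_1)
  have "(n + n') \<bullet> ((n \<bullet> w) *\<^sub>R n) = (n \<bullet> w) * (1 + n \<bullet> n')"
    using n by (simp add: inner_add_left inner_commute norm_eq_1 algebra_simps)
  then have "n \<bullet> w = 0"
    using w w1 c by (metis mult_eq_0_iff)
  then show ?thesis using True by simp
next
  case False
  have c: "1 + n \<bullet> n' \<noteq> 0" by (rule unit_inner_neq_minus_1[OF n])
  have "cross3 n n' \<bullet> u = - ((1 + n \<bullet> n') * (n \<bullet> w))"
    using w n by (simp add: u(1) dot_cross inner_add_left inner_commute norm_eq_1 algebra_simps)
  moreover have "n \<bullet> u = 0" "n' \<bullet> u = 0"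
    by (simp_all only: u(1) dot_cross_self, simp only: u(1)[symmetric] u(2) dot_cross_self)
  ultimately show ?thesis
    using norm_mult_tan_half_dihedral_angle[OF n, of u] False c by simp
qed

text \<open>
  The only vectors \<open>w\<close> with \<open>n \<times> w = u\<close> are \<open>- (n \<times> u)\<close> plus multiples of \<open>n\<close>. The formula below
  selects, symmetrically in \<open>n\<close> and \<open>n'\<close>, the one that is orthogonal to \<open>n + n'\<close>; the symmetry
  also makes it change sign when the edge is reversed.
\<close>

lemma edge_vector_solution:
  fixes n n' u :: "real^3"
  assumes n: "norm n = 1" "norm n' = 1" "n \<noteq> - n'" and u: "n \<bullet> u = 0" "n' \<bullet> u = 0"
  defines "w \<equiv> - (cross3 (n + n') u /\<^sub>R (1 + n \<bullet> n'))"
  shows "cross3 n w = u" "cross3 n' w = u" "(n + n') \<bullet> w = 0"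
proof -
  have c: "1 + n \<bullet> n' \<noteq> 0" by (rule unit_inner_neq_minus_1[OF n])
  show "(n + n') \<bullet> w = 0"
    by (simp add: w_def dot_cross_self)
  have "cross3 n (cross3 (n + n') u) = - ((1 + n \<bullet> n') *\<^sub>R u)"
    "cross3 n' (cross3 (n + n') u) = - ((1 + n \<bullet> n') *\<^sub>R u)"
    using n u by (simp_all add: Lagrange inner_add_right norm_eq_1 inner_commute algebra_simps)
  then show "cross3 n w = u" "cross3 n' w = u"
    using c by (simp_all add: w_def cross_mult_right)
qed

section \<open>The correspondence of A-minimal and C-minimal surfaces\<close>

lemma admissible_dart:
  assumes "discrete_surface M" "admissible M N" "d \<in> darts M"
  shows "norm (N (orig M d)) = 1" "norm (N (dest M d)) = 1" "N (orig M d) \<noteq> - N (dest M d)"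
  using assms dartD[OF assms(1,3)] by (auto simp: admissible_def)

lemma dual_diff_opp:
  assumes "discrete_surface M" "d \<in> darts M"
  shows "dual_diff M f (opp M d) = - dual_diff M f d"
  using dartD[OF assms] by (simp add: dual_diff_def)

text \<open>
  The mean curvature of \<open>g\<close> is the obstruction, in normal direction, to \<open>w\<close> being closed: it vanishes
  if \<open>w\<close> comes from a surface, and conversely has to vanish for \<open>w\<close> to come from one.
\<close>

lemma mean_curvature_eq:
  assumes M: "discrete_surface M" and N: "admissible M N" and v: "v \<in> int_verts M"
    and w: "\<And>d. d \<in> int_darts M \<Longrightarrow> (N (orig M d) + N (dest M d)) \<bullet> w d = 0 \<and>
      dual_diff M g d = cross3 (N (orig M d)) (w d) \<and> dual_diff M g d = cross3 (N (dest M d)) (w d)"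
  shows "mean_curvature M N g v = - (N v \<bullet> (\<Sum>d \<in> out_darts M v. w d))"
proof -
  have "mean_curvature M N g v = (\<Sum>d \<in> out_darts M v. - (N v \<bullet> w d))"
    unfolding mean_curvature_def
  proof (rule sum.cong[OF HOL.refl])
    fix d assume d: "d \<in> out_darts M v"
    then have i: "d \<in> int_darts M" "orig M d = v" by (simp_all add: out_dartsD[OF v])
    have wd: "(N (orig M d) + N (dest M d)) \<bullet> w d = 0"
      "dual_diff M g d = cross3 (N (orig M d)) (w d)" "dual_diff M g d = cross3 (N (dest M d)) (w d)"
      using w[OF i(1)] by blast+
    show "(if dual_diff M g d = 0 then 0 else norm (dual_diff M g d) *
        tan (dihedral_angle (N (orig M d)) (N (dest M d)) (dual_diff M g d) / 2)) = - (N v \<bullet> w d)"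
      using bend_term_eq[OF admissible_dart[OF M N int_dartD(1)[OF M i(1)]] wd] unfolding i(2) .
  qed
  then show ?thesis by (simp add: inner_sum_right sum_negf)
qed

text \<open>
  Since \<open>\<eta>\<close> can be written with the normal of either end point, it is antisymmetric, and at a vertex
  it is the cross product of one fixed normal with a closed form, hence closed.
\<close>

lemma C_minimal_from_A_minimal:
  assumes M: "discrete_surface M" "simply_connected_surface M" and A: "A_minimal M N f"
  shows "\<exists>g. C_minimal M N g \<and> (\<forall>d \<in> int_darts M.
           dual_diff M g d = cross3 (N (orig M d)) (dual_diff M f d) \<and>
           dual_diff M g d = cross3 (N (dest M d)) (dual_diff M f d))"
proof -
  define \<eta> where "\<eta> d = cross3 (N (orig M d)) (dual_diff M f d)" for d
  have N: "admissible M N" using A by (simp add: A_minimal_def)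
  have \<eta>_dest: "\<eta> d = cross3 (N (dest M d)) (dual_diff M f d)" if "d \<in> int_darts M" for d
    using A that by (auto simp: A_minimal_def \<eta>_def diff_def left_diff_distrib cross_minus_left
      Cross3.left_diff_distrib)
  have "\<eta> (opp M d) = - \<eta> d" if "d \<in> int_darts M" for d
    unfolding \<eta>_dest[OF that] using int_dartD[OF M(1) that] dartD[OF M(1)]
    by (simp add: \<eta>_def dual_diff_opp[OF M(1)] cross_minus_right)
  moreover have "(\<Sum>d \<in> out_darts M v. \<eta> d) = 0" if v: "v \<in> int_verts M" for v
  proof -
    have "(\<Sum>d \<in> out_darts M v. \<eta> d) = (\<Sum>d \<in> out_darts M v. cross3 (N v) (dual_diff M f d))"
      by (intro sum.cong) (auto simp: \<eta>_def out_darts_def)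
    also have "\<dots> = cross3 (N v) (\<Sum>d \<in> out_darts M v. dual_diff M f d)"
      by (rule cross3_sum_right[symmetric])
    finally show ?thesis by (simp add: sum_dual_diff_eq_0[OF M(1) v])
  qed
  ultimately obtain g where g: "\<And>d. d \<in> int_darts M \<Longrightarrow> dual_diff M g d = \<eta> d"
    using dual_closed_form_exact[where \<eta> = \<eta>, OF M] by blast
  have rel: "dual_diff M g d = cross3 (N (orig M d)) (dual_diff M f d) \<and>
      dual_diff M g d = cross3 (N (dest M d)) (dual_diff M f d)" if "d \<in> int_darts M" for d
    using g[OF that] \<eta>_dest[OF that] by (simp add: \<eta>_def)
  have "planar_faces M N g"
    using rel by (metis planar_faces_def dot_cross_self(1) orthogonal_def)
  moreover have "mean_curvature M N g v = 0" if v: "v \<in> int_verts M" for v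
  proof -
    have "mean_curvature M N g v = - (N v \<bullet> (\<Sum>d \<in> out_darts M v. dual_diff M f d))"
      by (rule mean_curvature_eq[OF M(1) N v]) (use rel A in \<open>unfold A_minimal_def, blast\<close>)
    then show ?thesis by (simp add: sum_dual_diff_eq_0[OF M(1) v])
  qed
  ultimately show ?thesis using N rel by (auto simp: C_minimal_def)
qed

text \<open>
  Closedness of \<open>w\<close> at a vertex takes two facts: the tangential part of the sum vanishes because \<open>g\<close> is
  a function on the faces, the normal part because the mean curvature does.
\<close>

lemma A_minimal_from_C_minimal:
  assumes M: "discrete_surface M" "simply_connected_surface M" and C: "C_minimal M N g"
  shows "\<exists>f. A_minimal M N f \<and> (\<forall>d \<in> int_darts M.
           dual_diff M g d = cross3 (N (orig M d)) (dual_diff M f d) \<and>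
           dual_diff M g d = cross3 (N (dest M d)) (dual_diff M f d))"
proof -
  define w where "w d = - (cross3 (N (orig M d) + N (dest M d)) (dual_diff M g d) /\<^sub>R
      (1 + N (orig M d) \<bullet> N (dest M d)))" for d
  have N: "admissible M N" using C by (simp add: C_minimal_def)
  have w: "dual_diff M g d = cross3 (N (orig M d)) (w d)" "dual_diff M g d = cross3 (N (dest M d)) (w d)"
    "(N (orig M d) + N (dest M d)) \<bullet> w d = 0" if d: "d \<in> int_darts M" for d
    using edge_vector_solution[OF admissible_dart[OF M(1) N int_dartD(1)[OF M(1) d]], of "dual_diff M g d"]
      C d by (auto simp: C_minimal_def planar_faces_def orthogonal_def w_def)
  have "w (opp M d) = - w d" if "d \<in> int_darts M" for d
    using int_dartD[OF M(1) that] dartD[OF M(1)]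
    by (simp add: w_def dual_diff_opp[OF M(1)] cross_minus_right add.commute inner_commute)
  moreover have "(\<Sum>d \<in> out_darts M v. w d) = 0" if v: "v \<in> int_verts M" for v
  proof -
    let ?W = "\<Sum>d \<in> out_darts M v. w d"
    have unit: "norm (N v) = 1"
      using N v by (auto simp: admissible_def int_verts_def)
    have "N v \<bullet> ?W = 0"
      using mean_curvature_eq[where w = w and g = g, OF M(1) N v] w C v by (simp add: C_minimal_def)
    moreover have "cross3 (N v) ?W = 0"
    proof -
      have "cross3 (N v) ?W = (\<Sum>d \<in> out_darts M v. cross3 (N v) (w d))"
        by (rule cross3_sum_right)
      also have "\<dots> = (\<Sum>d \<in> out_darts M v. dual_diff M g d)"
        using w(1) out_dartsD[OF v] by (intro sum.cong) auto
      finally show ?thesis by (simp add: sum_dual_diff_eq_0[OF M(1) v])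
    qed
    ultimately show ?thesis
      using unit norm_and_cross_eq_0 by (metis norm_zero zero_neq_one)
  qed
  ultimately obtain f where f: "\<And>d. d \<in> int_darts M \<Longrightarrow> dual_diff M f d = w d"
    using dual_closed_form_exact[where \<eta> = w, OF M] by blast
  have "cross3 (diff M N d) (dual_diff M f d) = 0" if "d \<in> int_darts M" for d
    using w(1,2)[OF that] f[OF that] by (simp add: diff_def Cross3.left_diff_distrib)
  then have "A_minimal M N f"
    using N f w(3) by (simp add: A_minimal_def)
  then show ?thesis using f w by auto
qed

theorem theorem4p3p1:
  fixes M :: "('v, 'e, 'f) surface" and N :: "'v \<Rightarrow> real^3"
  assumes "discrete_surface M" and "simply_connected_surface M" and "admissible M N"
  shows "(\<forall>f :: 'f \<Rightarrow> real^3. A_minimal M N f \<longrightarrow>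
            (\<exists>g :: 'f \<Rightarrow> real^3. C_minimal M N g \<and>
               (\<forall>d \<in> int_darts M.
                  dual_diff M g d = cross3 (N (orig M d)) (dual_diff M f d) \<and>
                  dual_diff M g d = cross3 (N (dest M d)) (dual_diff M f d)))) \<and>
         (\<forall>g :: 'f \<Rightarrow> real^3. C_minimal M N g \<longrightarrow>
            (\<exists>f :: 'f \<Rightarrow> real^3. A_minimal M N f \<and>
               (\<forall>d \<in> int_darts M.
                  dual_diff M g d = cross3 (N (orig M d)) (dual_diff M f d) \<and>
                  dual_diff M g d = cross3 (N (dest M d)) (dual_diff M f d))))"
proof (intro conjI allI impI)
  show "\<exists>g. C_minimal M N g \<and> (\<forall>d \<in> int_darts M.
      dual_diff M g d = cross3 (N (orig M d)) (dual_diff M f d) \<and>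
      dual_diff M g d = cross3 (N (dest M d)) (dual_diff M f d))"
    if "A_minimal M N f" for f :: "'f \<Rightarrow> real^3"
    by (rule C_minimal_from_A_minimal[OF assms(1,2) that])
  show "\<exists>f. A_minimal M N f \<and> (\<forall>d \<in> int_darts M.
      dual_diff M g d = cross3 (N (orig M d)) (dual_diff M f d) \<and>
      dual_diff M g d = cross3 (N (dest M d)) (dual_diff M f d))"
    if "C_minimal M N g" for g :: "'f \<Rightarrow> real^3"
    by (rule A_minimal_from_C_minimal[OF assms(1,2) that])
qed

end
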